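(* Let $K$ be a field and $d\geq 1$ an integer. The ring $\mathcal{M}(d)$ is isomorphic, as a graded $K$-algebra, to the (standard graded) polynomial ring in $d$ variables over $K$.
   Context: $\mathbb{N}=\{0,1,2,\ldots\}$. Let $S=K[x_i:i\in\mathbb{N}]$ be the standard graded polynomial ring in countably many variables and $S_d$ its degree $d$ component. $\mathcal{M}(d)$ is the $K$-vector space $S_d$ with the commutative associative multiplication $*$ defined on monomials by $$(x_{i_1}\cdots x_{i_d})*(x_{j_1}\cdots x_{j_d})=x_{i_1+j_1}x_{i_2+j_2}\cdots x_{i_d+j_d}\quad\text{for } i_1\leq\cdots\leq i_d,\ j_1\leq\cdots\leq j_d,$$ extended $K$-bilinearly; its unit is $x_0^d$. For a monomial $u\in S_d$ let $m(u)=\max\{e\in\mathbb{N}: x_e\text{ divides }u\}$. $\mathcal{M}(d)$ is graded by $\mathcal{M}(d)=\bigoplus_{e\in\mathbb{N}}\mathcal{M}(d)_e$, where $\mathcal{M}(d)_e$ is the $K$-span of the monomials $u\in S_d$ with $m(u)=e$. *)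

theory Defs
  imports Complex_Main "HOL-Algebra.QuotRing" "HOL-Algebra.Module" "HOL-Library.Poly_Mapping" "HOL-Library.Multiset"
begin

text \<open>
  The monomial \<open>x\<^sub>i\<^sub>1 \<cdots> x\<^sub>i\<^sub>d\<close> is the multiset \<open>{#i\<^sub>1, \<dots>, i\<^sub>d#}\<close>, so that the product of
  monomials is the sum of multisets and the total degree is \<open>size\<close>. The type \<open>'k poly_nat\<close>
  with the convolution product of \<^theory>\<open>HOL-Library.Poly_Mapping\<close> is then the
  polynomial ring \<open>S = K[x\<^sub>i : i \<in> \<nat>]\<close>.
\<close>

type_synonym 'k poly_nat = "nat multiset \<Rightarrow>\<^sub>0 'k"

definition monomial :: "nat multiset \<Rightarrow> 'k::field poly_nat" where
  "monomial u = Poly_Mapping.single u 1"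

text \<open>The empty multiset \<open>0\<close> is the monomial \<open>1\<close>, so \<open>Poly_Mapping.single 0 c\<close> is a constant.\<close>

definition poly_scale :: "'k::field \<Rightarrow> 'k poly_nat \<Rightarrow> 'k poly_nat" where
  "poly_scale c p = Poly_Mapping.single 0 c * p"

global_interpretation poly: vector_space poly_scale
  defines poly_span = poly.span
  by unfold_locales
     (simp_all add: poly_scale_def algebra_simps single_add mult_single
        flip: mult.assoc)

definition homogeneous_part :: "nat \<Rightarrow> 'k::field poly_nat set" where
  "homogeneous_part d = {p. \<forall>u\<in>Poly_Mapping.keys p. size u = d}"


subsection \<open>The algebra \<open>\<M>(d)\<close>\<close>

text \<open>Both arguments are meant to have the same degree; otherwise \<open>zip\<close> truncates.\<close>

definition monomial_star :: "nat multiset \<Rightarrow> nat multiset \<Rightarrow> nat multiset" where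
  "monomial_star u v =
     mset (map (\<lambda>(i, j). i + j) (zip (sorted_list_of_multiset u) (sorted_list_of_multiset v)))"

definition star :: "'k::field poly_nat \<Rightarrow> 'k poly_nat \<Rightarrow> 'k poly_nat" where
  "star p q = (\<Sum>u\<in>Poly_Mapping.keys p. \<Sum>v\<in>Poly_Mapping.keys q.
     poly_scale (Poly_Mapping.lookup p u * Poly_Mapping.lookup q v) (monomial (monomial_star u v)))"

lemma star_monomial: "star (monomial u) (monomial v) = (monomial (monomial_star u v) :: 'k::field poly_nat)"
  by (simp add: star_def monomial_def poly_scale_def mult_single)

lemma star_superset:
  assumes "finite A" "Poly_Mapping.keys p \<subseteq> A" "finite B" "Poly_Mapping.keys q \<subseteq> B"
  shows "star p q = (\<Sum>u\<in>A. \<Sum>v\<in>B.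
     poly_scale (Poly_Mapping.lookup p u * Poly_Mapping.lookup q v) (monomial (monomial_star u v)))"
proof -
  have "star p q = (\<Sum>u\<in>Poly_Mapping.keys p. \<Sum>v\<in>B.
     poly_scale (Poly_Mapping.lookup p u * Poly_Mapping.lookup q v) (monomial (monomial_star u v)))"
    unfolding star_def using assms
    by (intro sum.cong refl sum.mono_neutral_left) (auto simp: in_keys_iff)
  also have "\<dots> = (\<Sum>u\<in>A. \<Sum>v\<in>B.
     poly_scale (Poly_Mapping.lookup p u * Poly_Mapping.lookup q v) (monomial (monomial_star u v)))"
    using assms by (intro sum.mono_neutral_left) (auto simp: in_keys_iff)
  finally show ?thesis .
qed

lemma star_add_left: "star (p + p') q = star p q + star p' q"
proof -
  let ?A = "Poly_Mapping.keys p \<union> Poly_Mapping.keys p'"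
  have "Poly_Mapping.keys (p + p') \<subseteq> ?A"
    by (rule Poly_Mapping.keys_add)
  then show ?thesis
    by (simp add: star_superset[of ?A _ "Poly_Mapping.keys q"] lookup_add distrib_right
          poly.scale_left_distrib sum.distrib)
qed

lemma star_add_right: "star p (q + q') = star p q + star p q'"
proof -
  let ?B = "Poly_Mapping.keys q \<union> Poly_Mapping.keys q'"
  have "Poly_Mapping.keys (q + q') \<subseteq> ?B"
    by (rule Poly_Mapping.keys_add)
  then show ?thesis
    by (simp add: star_superset[of "Poly_Mapping.keys p" _ ?B] lookup_add distrib_left
          poly.scale_left_distrib sum.distrib)
qed

lemma lookup_poly_scale: "Poly_Mapping.lookup (poly_scale c p) u = c * Poly_Mapping.lookup p u"
proof -
  have "poly_scale c p = Poly_Mapping.map ((*) c) p"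
    by (simp add: poly_scale_def mult_map_scale_conv_mult)
  then show ?thesis
    by (simp add: Poly_Mapping.map.rep_eq when_def)
qed

lemma keys_poly_scale: "Poly_Mapping.keys (poly_scale c p) \<subseteq> Poly_Mapping.keys p"
  by (auto simp: in_keys_iff lookup_poly_scale)

lemma star_scale_left: "star (poly_scale c p) q = poly_scale c (star p q)"
  using keys_poly_scale[of c p]
  by (simp add: star_superset[of "Poly_Mapping.keys p" _ "Poly_Mapping.keys q"] lookup_poly_scale
        poly.scale_sum_right mult.assoc)

lemma star_scale_right: "star p (poly_scale c q) = poly_scale c (star p q)"
  using keys_poly_scale[of c q]
  by (simp add: star_superset[of "Poly_Mapping.keys p" _ "Poly_Mapping.keys q"] lookup_poly_scale
        poly.scale_sum_right ac_simps)

definition M_alg :: "nat \<Rightarrow> ('k::field, 'k poly_nat) module" where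
  "M_alg d = \<lparr>carrier = homogeneous_part d, monoid.mult = star, one = monomial (replicate_mset d 0),
              zero = 0, add = (+), smult = poly_scale\<rparr>"

definition max_index :: "nat multiset \<Rightarrow> nat" where
  "max_index u = Max (set_mset u)"

definition M_part :: "nat \<Rightarrow> nat \<Rightarrow> 'k::field poly_nat set" where
  "M_part d e = poly_span {monomial u |u. size u = d \<and> max_index u = e}"


subsection \<open>The polynomial ring in \<open>d\<close> variables\<close>

text \<open>It is realised as the subalgebra \<open>K[x\<^sub>0, \<dots>, x\<^sub>d\<^sub>-\<^sub>1]\<close> of \<open>S\<close>, with the product of \<open>S\<close>.\<close>

definition polys_in_vars :: "nat \<Rightarrow> 'k::field poly_nat set" where
  "polys_in_vars d = {p. \<forall>u\<in>Poly_Mapping.keys p. set_mset u \<subseteq> {..<d}}"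

definition P_alg :: "nat \<Rightarrow> ('k::field, 'k poly_nat) module" where
  "P_alg d = \<lparr>carrier = polys_in_vars d, monoid.mult = (*), one = 1,
              zero = 0, add = (+), smult = poly_scale\<rparr>"

definition P_part :: "nat \<Rightarrow> nat \<Rightarrow> 'k::field poly_nat set" where
  "P_part d e = polys_in_vars d \<inter> homogeneous_part e"


subsection \<open>Isomorphisms of graded algebras\<close>

text \<open>\<open>A\<^sub>e = \<A> e\<close> and \<open>B\<^sub>e = \<B> e\<close> are the graded pieces; the scalars are all of the type \<open>'k\<close>.\<close>

definition graded_algebra_iso ::
  "('k::field, 'a) module \<Rightarrow> (nat \<Rightarrow> 'a set) \<Rightarrow> ('k, 'b) module \<Rightarrow> (nat \<Rightarrow> 'b set) \<Rightarrow> ('a \<Rightarrow> 'b) \<Rightarrow> bool"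
where
  "graded_algebra_iso A \<A> B \<B> \<phi> \<longleftrightarrow>
     \<phi> \<in> ring_iso A B \<and>
     (\<forall>c. \<forall>x\<in>carrier A. \<phi> (c \<odot>\<^bsub>A\<^esub> x) = c \<odot>\<^bsub>B\<^esub> \<phi> x) \<and>
     (\<forall>e. \<phi> ` \<A> e = \<B> e)"

end

theory Submission
  imports Defs
begin

text \<open>
  A monomial \<open>u = x\<^sub>i\<^sub>1 \<cdots> x\<^sub>i\<^sub>d\<close> with \<open>i\<^sub>1 \<le> \<dots> \<le> i\<^sub>d\<close> is determined by its gaps
  \<open>i\<^sub>1, i\<^sub>2 - i\<^sub>1, \<dots>, i\<^sub>d - i\<^sub>d\<^sub>-\<^sub>1\<close>, and these can be any \<open>d\<close> natural numbers. The product
  of \<open>\<M>(d)\<close> adds sorted index sequences entry by entry, so it adds gaps, and the largest index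
  is the sum of the gaps. Reading the gaps as the exponents of a monomial in \<open>d\<close> variables
  therefore identifies the monomial basis of \<open>\<M>(d)\<close> with that of the polynomial ring,
  with products and degrees matching; the linear extension of this bijection is the isomorphism.

  The proof describes the bijection from the side of the polynomial ring, where it takes the partial
  sums of the exponents (\<open>partial_sums\<close>). This direction is visibly additive, since
  adding sorted lists gives a sorted list (\<open>partial_sums_add\<close>); it is onto because the
  differences of a monotone sequence are natural numbers (\<open>ex_mset_of_partial_sums\<close>).
  Everything linear is done once for an arbitrary map of exponents: a bijection
  of exponents induces a bijection between the polynomials supported on them
  (\<open>bij_betw_reindex\<close>), which gives bijectivity and compatibility with the gradings alike.
\<close>

section \<open>Linear extension of a map of exponents\<close>

definition reindex :: "('a \<Rightarrow> 'b) \<Rightarrow> ('a \<Rightarrow>\<^sub>0 'k::comm_monoid_add) \<Rightarrow> 'b \<Rightarrow>\<^sub>0 'k" where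
  "reindex h p = (\<Sum>u\<in>Poly_Mapping.keys p. Poly_Mapping.single (h u) (Poly_Mapping.lookup p u))"

lemma reindex_superset:
  assumes "finite A" "Poly_Mapping.keys p \<subseteq> A"
  shows "reindex h p = (\<Sum>u\<in>A. Poly_Mapping.single (h u) (Poly_Mapping.lookup p u))"
  unfolding reindex_def using assms
  by (intro sum.mono_neutral_left) (auto simp: in_keys_iff)

lemma reindex_single: "reindex h (Poly_Mapping.single u c) = Poly_Mapping.single (h u) c"
  by (simp add: reindex_superset[of "{u}"])

lemma reindex_zero: "reindex h 0 = 0"
  by (simp add: reindex_def)

lemma reindex_add: "reindex h (p + q) = reindex h p + reindex h q"
proof -
  let ?A = "Poly_Mapping.keys p \<union> Poly_Mapping.keys q"
  have "Poly_Mapping.keys (p + q) \<subseteq> ?A"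
    by (rule Poly_Mapping.keys_add)
  then show ?thesis
    by (simp add: reindex_superset[of ?A] lookup_add single_add sum.distrib)
qed

lemma reindex_sum: "reindex h (\<Sum>i\<in>I. f i) = (\<Sum>i\<in>I. reindex h (f i))"
  by (induction I rule: infinite_finite_induct) (auto simp: reindex_zero reindex_add)

lemma keys_reindex: "Poly_Mapping.keys (reindex h p) \<subseteq> h ` Poly_Mapping.keys p"
proof -
  have "Poly_Mapping.keys (reindex h p) \<subseteq>
      (\<Union>u\<in>Poly_Mapping.keys p. Poly_Mapping.keys (Poly_Mapping.single (h u) (Poly_Mapping.lookup p u)))"
    unfolding reindex_def by (rule Poly_Mapping.keys_sum)
  also have "\<dots> \<subseteq> h ` Poly_Mapping.keys p"
    by (auto split: if_splits)
  finally show ?thesis .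
qed

lemma reindex_cong:
  assumes "\<And>u. u \<in> Poly_Mapping.keys p \<Longrightarrow> h u = g u"
  shows "reindex h p = reindex g p"
  using assms by (simp add: reindex_def)

lemma sum_single_lookup:
  "(\<Sum>u\<in>Poly_Mapping.keys p. Poly_Mapping.single u (Poly_Mapping.lookup p u)) = p"
  by (rule poly_mapping_eqI) (simp add: lookup_sum lookup_single when_def in_keys_iff)

lemma reindex_ident: "reindex (\<lambda>u. u) p = p"
  by (simp add: reindex_def sum_single_lookup)

lemma reindex_reindex: "reindex g (reindex h p) = reindex (\<lambda>u. g (h u)) p"
  by (simp add: reindex_def[of h] reindex_def[of "\<lambda>u. g (h u)"] reindex_sum reindex_single)

lemma bij_betw_reindex:
  assumes "bij_betw h A B"
  shows "bij_betw (reindex h :: ('a \<Rightarrow>\<^sub>0 'k::comm_monoid_add) \<Rightarrow> 'b \<Rightarrow>\<^sub>0 'k)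
    {p. Poly_Mapping.keys p \<subseteq> A} {q. Poly_Mapping.keys q \<subseteq> B}"
proof (rule bij_betwI)
  let ?g = "inv_into A h"
  have g: "?g w \<in> A" if "w \<in> B" for w
    using assms that by (metis bij_betw_def inv_into_into)
  show "reindex h \<in> {p. Poly_Mapping.keys p \<subseteq> A} \<rightarrow> {q. Poly_Mapping.keys q \<subseteq> B}"
    using keys_reindex[of h] bij_betw_imp_surj_on[OF assms] by blast
  show "reindex ?g \<in> {q. Poly_Mapping.keys q \<subseteq> B} \<rightarrow> {p. Poly_Mapping.keys p \<subseteq> A}"
    using keys_reindex[of ?g] g by blast
  show "reindex ?g (reindex h p) = p" if "p \<in> {p. Poly_Mapping.keys p \<subseteq> A}" for p :: "'a \<Rightarrow>\<^sub>0 'k"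
  proof -
    have "reindex (\<lambda>u. ?g (h u)) p = reindex (\<lambda>u. u) p"
      using that assms by (intro reindex_cong) (auto simp: bij_betw_inv_into_left)
    then show ?thesis by (simp add: reindex_reindex reindex_ident)
  qed
  show "reindex h (reindex ?g q) = q" if "q \<in> {q. Poly_Mapping.keys q \<subseteq> B}" for q :: "'b \<Rightarrow>\<^sub>0 'k"
  proof -
    have "reindex (\<lambda>w. h (?g w)) q = reindex (\<lambda>w. w) q"
      using that assms by (intro reindex_cong) (auto simp: bij_betw_inv_into_right)
    then show ?thesis by (simp add: reindex_reindex reindex_ident)
  qed
qed

lemma poly_scale_single: "poly_scale c (Poly_Mapping.single u a) = Poly_Mapping.single u (c * a)"
  by (simp add: poly_scale_def mult_single)

lemma reindex_scale: "reindex h (poly_scale c p) = poly_scale c (reindex h p)"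
  using keys_poly_scale[of c p]
  by (simp add: reindex_superset[of "Poly_Mapping.keys p"] lookup_poly_scale
      poly.scale_sum_right poly_scale_single)

text \<open>Both products are bilinear, so it suffices that they agree on the monomials that occur.\<close>

lemma reindex_star:
  fixes p q :: "'k::field poly_nat"
  assumes "\<And>u v. \<lbrakk>u \<in> Poly_Mapping.keys p; v \<in> Poly_Mapping.keys q\<rbrakk> \<Longrightarrow> h (monomial_star u v) = h u + h v"
  shows "reindex h (star p q) = reindex h p * reindex h q"
proof -
  have "reindex h (star p q) = (\<Sum>u\<in>Poly_Mapping.keys p. \<Sum>v\<in>Poly_Mapping.keys q.
      Poly_Mapping.single (h u + h v) (Poly_Mapping.lookup p u * Poly_Mapping.lookup q v))"
    unfolding star_def by (simp add: reindex_sum monomial_def poly_scale_single reindex_single assms)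
  also have "\<dots> = reindex h p * reindex h q"
    by (simp add: reindex_def sum_product mult_single)
  finally show ?thesis .
qed

lemma span_monomials: "poly_span (monomial ` A) = {p :: 'k::field poly_nat. Poly_Mapping.keys p \<subseteq> A}"
proof
  have "poly.subspace {p :: 'k poly_nat. Poly_Mapping.keys p \<subseteq> A}"
    unfolding poly.subspace_def
  proof (intro conjI ballI allI)
    fix p q :: "'k poly_nat" and c
    assume p: "p \<in> {p. Poly_Mapping.keys p \<subseteq> A}"
    then show "poly_scale c p \<in> {p. Poly_Mapping.keys p \<subseteq> A}"
      using keys_poly_scale[of c p] by blast
    assume "q \<in> {p. Poly_Mapping.keys p \<subseteq> A}"
    then show "p + q \<in> {p. Poly_Mapping.keys p \<subseteq> A}"
      using p Poly_Mapping.keys_add[of p q] by blast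
  qed simp
  then show "poly_span (monomial ` A) \<subseteq> {p :: 'k poly_nat. Poly_Mapping.keys p \<subseteq> A}"
    by (intro poly.span_minimal) (auto simp: monomial_def)
  show "{p :: 'k poly_nat. Poly_Mapping.keys p \<subseteq> A} \<subseteq> poly_span (monomial ` A)"
  proof clarify
    fix p :: "'k poly_nat" assume "Poly_Mapping.keys p \<subseteq> A"
    then have "(\<Sum>u\<in>Poly_Mapping.keys p. poly_scale (Poly_Mapping.lookup p u) (monomial u))
        \<in> poly_span (monomial ` A)"
      by (intro poly.span_sum poly.span_scale poly.span_base) auto
    then show "p \<in> poly_span (monomial ` A)"
      by (simp add: monomial_def poly_scale_single sum_single_lookup)
  qed
qed

section \<open>Index sequences as partial sums of exponents\<close>

text \<open>
  The size of \<open>{#j \<in># w. j \<le> k#}\<close> is the sum of the exponents of \<open>x\<^sub>0, \<dots>, x\<^sub>k\<close> in \<open>w\<close>. Counting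
  by a filter rather than summing \<open>count w\<close> makes additivity in \<open>w\<close> and monotonicity in \<open>k\<close>
  immediate.
\<close>

definition partial_sum :: "nat multiset \<Rightarrow> nat \<Rightarrow> nat" where
  "partial_sum w k = size {#j \<in># w. j \<le> k#}"

definition partial_sums :: "nat \<Rightarrow> nat multiset \<Rightarrow> nat multiset" where
  "partial_sums d w = mset (map (partial_sum w) [0..<d])"

lemma mono_partial_sum: "mono (partial_sum w)"
proof (rule monoI)
  fix k l :: nat assume "k \<le> l"
  then show "partial_sum w k \<le> partial_sum w l"
    by (induction w) (auto simp: partial_sum_def)
qed

lemma partial_sum_add: "partial_sum (v + w) = (\<lambda>k. partial_sum v k + partial_sum w k)"
  by (simp add: partial_sum_def fun_eq_iff)

lemma size_partial_sums: "size (partial_sums d w) = d"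
  by (simp add: partial_sums_def)

lemma sorted_list_of_partial_sums:
  "sorted_list_of_multiset (partial_sums d w) = map (partial_sum w) [0..<d]"
proof -
  have "sorted (map (partial_sum w) [0..<d])"
    using mono_partial_sum by (auto simp: sorted_iff_nth_mono monoD)
  then show ?thesis
    by (simp add: partial_sums_def sorted_sort_id del: mset_map mset_upt)
qed

lemma partial_sums_add:
  "partial_sums d (v + w) = monomial_star (partial_sums d v) (partial_sums d w)"
  unfolding monomial_star_def sorted_list_of_partial_sums
  by (simp add: partial_sums_def partial_sum_add zip_map_map zip_same_conv_map o_def
      del: mset_map mset_upt)

lemma partial_sums_zero: "partial_sums d 0 = replicate_mset d 0"
proof -
  have "partial_sum 0 = (\<lambda>k. 0)"
    by (simp add: partial_sum_def fun_eq_iff)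
  then show ?thesis
    by (simp add: partial_sums_def map_replicate_const del: mset_map mset_upt)
qed

text \<open>The exponents are the successive differences of the partial sums.\<close>

lemma mset_eqI_partial_sum:
  assumes "set_mset v \<subseteq> {..<d}" "set_mset w \<subseteq> {..<d}"
    and eq: "\<And>k. k < d \<Longrightarrow> partial_sum v k = partial_sum w k"
  shows "v = w"
proof (rule multiset_eqI)
  fix k
  have Suc: "partial_sum x (Suc k) = partial_sum x k + count x (Suc k)" for x k
    by (induction x) (auto simp: partial_sum_def le_Suc_eq)
  have zero: "partial_sum x 0 = count x 0" for x
    by (induction x) (auto simp: partial_sum_def)
  show "count v k = count w k"
  proof (cases "k < d")
    case True
    then show ?thesis
      using eq[of k] eq[of "k - 1"] Suc[of v "k - 1"] Suc[of w "k - 1"] zero[of v] zero[of w]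
      by (cases k) auto
  next
    case False
    then have "k \<notin># v" "k \<notin># w" using assms(1,2) by auto
    then show ?thesis by (simp add: not_in_iff)
  qed
qed

text \<open>Each new exponent is the difference of the last two prescribed values, which is where
  monotonicity enters.\<close>

lemma ex_mset_of_partial_sums:
  assumes "mono_on {..<d} f"
  shows "\<exists>w. set_mset w \<subseteq> {..<d} \<and> (\<forall>k<d. partial_sum w k = f k)"
  using assms
proof (induction d)
  case 0
  show ?case by (intro exI[of _ "{#}"]) simp
next
  case (Suc d)
  then have "mono_on {..<d} f"
    by (auto intro: mono_on_subset)
  from Suc.IH[OF this] obtain w where w: "set_mset w \<subseteq> {..<d}" "\<forall>k<d. partial_sum w k = f k"
    by blast
  have all: "partial_sum w d = size w"
    using w(1) by (auto simp: partial_sum_def intro!: arg_cong[of _ _ size] filter_mset_eq_conv[THEN iffD2])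
  have le: "size w \<le> f d"
  proof (cases d)
    case 0
    then show ?thesis using w(1) by simp
  next
    case (Suc e)
    have "{#j \<in># w. j \<le> e#} = w"
      using w(1) Suc by (auto simp: filter_mset_eq_conv)
    then have "size w = f e"
      using w(2) Suc by (auto simp: partial_sum_def dest: spec[of _ e])
    then show ?thesis
      using Suc Suc.prems by (auto simp: mono_on_def)
  qed
  let ?w = "w + replicate_mset (f d - size w) d"
  have "partial_sum ?w k = f k" if "k < Suc d" for k
  proof (cases "k = d")
    case True
    have "{#j \<in># replicate_mset n d. j \<le> d#} = replicate_mset n d" for n
      by (induction n) auto
    then show ?thesis
      using True all le by (simp add: partial_sum_def)
  next
    case False
    then have "{#j \<in># replicate_mset n d. j \<le> k#} = {#}" for n
      using that by (induction n) auto
    then show ?thesis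
      using False that w(2) by (simp add: partial_sum_def)
  qed
  moreover have "set_mset ?w \<subseteq> {..<Suc d}"
    using w(1) by (auto split: if_splits)
  ultimately show ?case by blast
qed

lemma bij_betw_partial_sums:
  "bij_betw (partial_sums d) {w. set_mset w \<subseteq> {..<d}} {u. size u = d}"
  unfolding bij_betw_def
proof
  show "inj_on (partial_sums d) {w. set_mset w \<subseteq> {..<d}}"
  proof (rule inj_onI, clarify)
    fix v w assume vw: "set_mset v \<subseteq> {..<d}" "set_mset w \<subseteq> {..<d}" "partial_sums d v = partial_sums d w"
    then have "map (partial_sum v) [0..<d] = map (partial_sum w) [0..<d]"
      by (metis sorted_list_of_partial_sums)
    then show "v = w"
      using vw by (intro mset_eqI_partial_sum) auto
  qed
  show "partial_sums d ` {w. set_mset w \<subseteq> {..<d}} = {u. size u = d}"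
  proof (intro equalityI subsetI)
    fix u :: "nat multiset" assume "u \<in> {u. size u = d}"
    then have len: "length (sorted_list_of_multiset u) = d"
      by (simp flip: size_mset)
    let ?l = "sorted_list_of_multiset u"
    have "mono_on {..<d} (nth ?l)"
      using len by (auto simp: mono_on_def intro!: sorted_nth_mono)
    then obtain w where w: "set_mset w \<subseteq> {..<d}" "\<forall>k<d. partial_sum w k = ?l ! k"
      using ex_mset_of_partial_sums by blast
    have "map (partial_sum w) [0..<d] = ?l"
      using w(2) len by (intro nth_equalityI) auto
    then have "partial_sums d w = u"
      by (simp add: partial_sums_def)
    then show "u \<in> partial_sums d ` {w. set_mset w \<subseteq> {..<d}}"
      using w(1) by blast
  qed (auto simp: size_partial_sums)
qed

text \<open>The largest partial sum is the last one, which is the sum of all exponents.\<close>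

lemma max_index_partial_sums:
  assumes "d \<ge> 1" "set_mset w \<subseteq> {..<d}"
  shows "max_index (partial_sums d w) = size w"
proof -
  have "{#j \<in># w. j \<le> d - 1#} = w"
    using assms by (auto simp: filter_mset_eq_conv)
  then have "partial_sum w (d - 1) = size w"
    by (simp add: partial_sum_def)
  moreover have "Max (partial_sum w ` {0..<d}) = partial_sum w (d - 1)"
    using assms(1) mono_partial_sum[of w] by (intro Max_eqI) (auto simp: monoD)
  ultimately show ?thesis
    by (simp add: max_index_def partial_sums_def)
qed

section \<open>The isomorphism\<close>

theorem proposition2p1:
  fixes d :: nat
  assumes "d \<ge> 1"
  shows "\<exists>\<phi> :: 'k::field poly_nat \<Rightarrow> 'k poly_nat.
    graded_algebra_iso (M_alg d) (M_part d) (P_alg d) (P_part d) \<phi>"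
proof -
  let ?W = "{w :: nat multiset. set_mset w \<subseteq> {..<d}}" and ?U = "{u :: nat multiset. size u = d}"
  define gaps where "gaps = inv_into ?W (partial_sums d)"
  let ?\<phi> = "reindex gaps :: 'k poly_nat \<Rightarrow> 'k poly_nat"
  have gaps_sums: "gaps (partial_sums d w) = w" if "w \<in> ?W" for w
    unfolding gaps_def using bij_betw_partial_sums that by (rule bij_betw_inv_into_left)
  have sums_gaps: "partial_sums d (gaps u) = u" if "u \<in> ?U" for u
    unfolding gaps_def using bij_betw_partial_sums that by (rule bij_betw_inv_into_right)
  have bij: "bij_betw gaps ?U ?W"
    unfolding gaps_def using bij_betw_partial_sums by (rule bij_betw_inv_into)
  have gaps_star: "gaps (monomial_star u v) = gaps u + gaps v" if "u \<in> ?U" "v \<in> ?U" for u v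
  proof -
    have "gaps u + gaps v \<in> ?W"
      using that bij_betwE[OF bij] by auto
    then show ?thesis
      using gaps_sums[of "gaps u + gaps v"] that by (simp add: partial_sums_add sums_gaps)
  qed
  have gaps_one: "gaps (replicate_mset d 0) = 0"
    using gaps_sums[of 0] by (simp add: partial_sums_zero)
  have homogeneous: "homogeneous_part d = {p :: 'k poly_nat. Poly_Mapping.keys p \<subseteq> ?U}"
    by (auto simp: homogeneous_part_def)
  have bij_\<phi>: "bij_betw ?\<phi> (homogeneous_part d) (polys_in_vars d)"
    using bij_betw_reindex[OF bij, where 'k = 'k]
    by (simp add: homogeneous polys_in_vars_def subset_eq[of "Poly_Mapping.keys _"])
  have "?\<phi> \<in> ring_iso (M_alg d) (P_alg d)"
  proof (rule ring_iso_memI)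
    show "?\<phi> p \<in> carrier (P_alg d)" if "p \<in> carrier (M_alg d)" for p
      using that bij_betwE[OF bij_\<phi>] by (simp add: M_alg_def P_alg_def)
    show "?\<phi> (p \<otimes>\<^bsub>M_alg d\<^esub> q) = ?\<phi> p \<otimes>\<^bsub>P_alg d\<^esub> ?\<phi> q"
      if "p \<in> carrier (M_alg d)" "q \<in> carrier (M_alg d)" for p q
      using that by (auto simp: M_alg_def P_alg_def homogeneous_part_def intro!: reindex_star gaps_star)
    show "?\<phi> (p \<oplus>\<^bsub>M_alg d\<^esub> q) = ?\<phi> p \<oplus>\<^bsub>P_alg d\<^esub> ?\<phi> q" for p q
      by (simp add: M_alg_def P_alg_def reindex_add)
    show "?\<phi> \<one>\<^bsub>M_alg d\<^esub> = \<one>\<^bsub>P_alg d\<^esub>"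
      by (simp add: M_alg_def P_alg_def monomial_def reindex_single gaps_one)
    show "bij_betw ?\<phi> (carrier (M_alg d)) (carrier (P_alg d))"
      using bij_\<phi> by (simp add: M_alg_def P_alg_def)
  qed
  moreover have "?\<phi> (c \<odot>\<^bsub>M_alg d\<^esub> p) = c \<odot>\<^bsub>P_alg d\<^esub> ?\<phi> p" for c p
    by (simp add: M_alg_def P_alg_def reindex_scale)
  moreover have "?\<phi> ` M_part d e = P_part d e" for e
  proof -
    let ?Ue = "{u. size u = d \<and> max_index u = e}" and ?We = "{w \<in> ?W. size w = e}"
    have max: "max_index u = size (gaps u)" if "u \<in> ?U" for u
      using max_index_partial_sums[OF assms, of "gaps u"] that bij_betwE[OF bij] by (auto simp: sums_gaps)
    have "gaps ` ?Ue = ?We"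
      using bij_betw_imp_surj_on[OF bij] max by force
    moreover have "inj_on gaps ?Ue"
      using bij_betw_imp_inj_on[OF bij] by (rule inj_on_subset) auto
    ultimately have "bij_betw gaps ?Ue ?We"
      by (simp add: bij_betw_def)
    from bij_betw_imp_surj_on[OF bij_betw_reindex[OF this, where 'k = 'k]]
    have "?\<phi> ` {p. Poly_Mapping.keys p \<subseteq> ?Ue} = {q. Poly_Mapping.keys q \<subseteq> ?We}" .
    moreover have "M_part d e = {p :: 'k poly_nat. Poly_Mapping.keys p \<subseteq> ?Ue}"
      unfolding M_part_def span_monomials[symmetric] by (simp add: setcompr_eq_image)
    moreover have "P_part d e = {q :: 'k poly_nat. Poly_Mapping.keys q \<subseteq> ?We}"
      by (auto simp: P_part_def polys_in_vars_def homogeneous_part_def)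
    ultimately show ?thesis
      by (simp only:)
  qed
  ultimately show ?thesis
    unfolding graded_algebra_iso_def by blast
qed

end
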